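(* Let the relay throughput $R_{\mathrm{full}}(\theta)$ and the minimum detection range $R_{\mathrm{target}}(\theta)$ both depend on the orbital phase $\theta$. The orbit-averaged throughput maximization $$\max_{\rho(\theta)}\ \int_0^{2\pi}\bigl(1-\rho(\theta)\bigr)\,R_{\mathrm{full}}(\theta)\,w(\theta)\,d\theta$$ subject to $R_{\max}\bigl(\theta,\rho(\theta)\bigr)\ge R_{\mathrm{target}}(\theta)$ for all $\theta$ and $0\le\rho(\theta)\le1$, where $w(\theta)$ is the dwell-time weight extracted from the reference trajectory of the spacecraft in the circular restricted three-body problem (approximately $\propto r(\theta)^2$), admits the following pointwise solution under continuous relaxation of $K$ and non-binding beam dwell: $$\rho^*(\theta)=\frac{T_{\mathrm{CPI}}^*(\theta)}{T_{\mathrm{obs}}}\cdot\left(\frac{R_{\mathrm{target}}(\theta)^4}{C(\theta)}\right)^{1/\kappa},$$ where $$C(\theta)=\frac{\mathrm{EIRP}\cdot G_r\,\lambda^2\,\sigma\,N_{\mathrm{sc}}^*(\theta)\,M^*(\theta)\,\mathcal{G}^*(\theta)}{(4\pi)^3\,k_B\,T_{\mathrm{sys}}\,B\,\gamma_{\mathrm{th}}}$$ is the single-CPI sensing figure of merit at phase $\theta$.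
   Context: A spacecraft on a periodic orbit with phase $\theta\in[0,2\pi)$ and orbital radius $r(\theta)$ uses its OFDM communication link for monostatic radar sensing. $\rho(\theta)$ is the fraction of a relay session of duration $T_{\mathrm{obs}}$ allocated to sensing at phase $\theta$. The sensing time is divided into coherent processing intervals (CPIs) of duration $T_{\mathrm{CPI}}^*(\theta)=\min\bigl(c/(2B\,v_{\mathrm{rel}}(\theta)),\,T_{\mathrm{obs}}\bigr)$, where $c$ is the speed of light, $B$ the bandwidth and $v_{\mathrm{rel}}(\theta)$ the relative velocity of the target. $K$ is the number of CPIs integrated non-coherently. Continuous relaxation of $K$ means that $K=\rho(\theta)\,T_{\mathrm{obs}}/T_{\mathrm{CPI}}^*(\theta)$ is not rounded to an integer; non-binding beam dwell means that the upper limit on $K$ imposed by the finite time the target spends in the antenna beam is not active. The maximum detection range is then given by $$R_{\max}(\theta,\rho)^4=C(\theta)\,K^{\kappa},$$ with non-coherent integration efficiency exponent $\kappa\approx0.85$. The other quantities are: $\mathrm{EIRP}$, effective isotropic radiated power; $G_r$, receive antenna gain; $\lambda$, wavelength; $\sigma$, radar cross section; $k_B$, Boltzmann's constant; $T_{\mathrm{sys}}$, system noise temperature; $\gamma_{\mathrm{th}}$, Swerling I detection threshold; $N_{\mathrm{sc}}^*(\theta)$, $M^*(\theta)$ and $\mathcal{G}^*(\theta)$, respectively the subcarrier count, the number of OFDM symbols per CPI of duration $T_{\mathrm{CPI}}^*(\theta)$, and the coherent processing efficiency in use at phase $\theta$ (none of which depends on $\rho$).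
   Formalization: The formal theorem adds the assumption that some measurable allocation satisfies all the constraints (otherwise the given solution can exceed 1 and no solution exists), and takes the data measurable with integrable weighted throughput. *)

theory Defs
  imports "HOL-Analysis.Analysis"
begin

(* Circular restricted three-body problem: rotating frame, nondimensional units, primaries of mass
   1 - \<mu> at (-\<mu>, 0, 0) and \<mu> at (1 - \<mu>, 0, 0). X is the position, V the velocity. *)

definition primary1 :: "real \<Rightarrow> real^3" where
  "primary1 \<mu> = vector [- \<mu>, 0, 0]"

definition primary2 :: "real \<Rightarrow> real^3" where
  "primary2 \<mu> = vector [1 - \<mu>, 0, 0]"

(* Coriolis and centrifugal terms followed by the attraction of the two primaries. *)
definition cr3bp_acceleration :: "real \<Rightarrow> real^3 \<Rightarrow> real^3 \<Rightarrow> real^3" where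
  "cr3bp_acceleration \<mu> p v =
     vector [2 * v $ 2 + p $ 1, - 2 * v $ 1 + p $ 2, 0]
     - ((1 - \<mu>) / norm (p - primary1 \<mu>) ^ 3) *\<^sub>R (p - primary1 \<mu>)
     - (\<mu> / norm (p - primary2 \<mu>) ^ 3) *\<^sub>R (p - primary2 \<mu>)"

definition cr3bp_trajectory :: "real \<Rightarrow> (real \<Rightarrow> real^3) \<Rightarrow> (real \<Rightarrow> real^3) \<Rightarrow> bool" where
  "cr3bp_trajectory \<mu> X V \<longleftrightarrow>
     (\<forall>t. X t \<noteq> primary1 \<mu> \<and> X t \<noteq> primary2 \<mu> \<and>
          (X has_vector_derivative V t) (at t) \<and>
          (V has_vector_derivative cr3bp_acceleration \<mu> (X t) (V t)) (at t))"

definition has_least_period :: "(real \<Rightarrow> 'a) \<Rightarrow> real \<Rightarrow> bool" where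
  "has_least_period f P \<longleftrightarrow>
     0 < P \<and> (\<forall>t. f (t + P) = f t) \<and> (\<forall>s. 0 < s \<and> s < P \<longrightarrow> (\<exists>t. f (t + s) \<noteq> f t))"

(* The phase as a function of time: every value in [0, 2 pi) is taken once per period, and the
   phase is continuous modulo 2 pi. No particular choice of phase angle is imposed. *)
definition orbit_phase :: "real \<Rightarrow> (real \<Rightarrow> real) \<Rightarrow> bool" where
  "orbit_phase P \<phi> \<longleftrightarrow>
     bij_betw \<phi> {0..<P} {0..<2*pi} \<and> (\<forall>t. \<phi> (t + P) = \<phi> t) \<and>
     continuous_on UNIV (\<lambda>t. cis (\<phi> t))"

(* The integral of w over a set of phases is proportional to the time per period spent in it, i.e.
   w is dt/d\<theta> up to a positive factor a, which absorbs time units and any normalisation. *)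
definition dwell_time_weight :: "real \<Rightarrow> (real \<Rightarrow> real) \<Rightarrow> (real \<Rightarrow> real) \<Rightarrow> bool" where
  "dwell_time_weight P \<phi> w \<longleftrightarrow>
     set_borel_measurable lborel {0..<2*pi} w \<and> (\<forall>\<theta>\<in>{0..<2*pi}. 0 \<le> w \<theta>) \<and>
     (\<exists>a>0. \<forall>A\<in>sets borel. A \<subseteq> {0..<2*pi} \<longrightarrow>
        (\<integral>\<^sup>+\<theta>\<in>A. ennreal (w \<theta>) \<partial>lborel) =
          ennreal a * emeasure lborel {t\<in>{0..<P}. \<phi> t \<in> A})"

(* The functions of type real => _ take the orbital phase; max_beam_cpis is the upper limit on the
   number of integrated CPIs imposed by the time the target spends in the antenna beam. *)
record sensing_system =
  eirp :: real
  rx_gain :: real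
  wavelength :: real
  radar_cross_section :: real
  boltzmann :: real
  system_temp :: real
  bandwidth :: real
  det_threshold :: real
  light_speed :: real
  obs_time :: real
  integration_exponent :: real
  rel_velocity :: "real \<Rightarrow> real"
  num_subcarriers :: "real \<Rightarrow> nat"
  num_symbols :: "real \<Rightarrow> nat"
  efficiency :: "real \<Rightarrow> real"
  max_beam_cpis :: "real \<Rightarrow> real"

(* Regularity and positivity of the data only; max_beam_cpis is left unconstrained. *)
definition valid_system :: "sensing_system \<Rightarrow> bool" where
  "valid_system S \<longleftrightarrow>
     0 < eirp S \<and> 0 < rx_gain S \<and> 0 < wavelength S \<and> 0 < radar_cross_section S \<and>
     0 < boltzmann S \<and> 0 < system_temp S \<and> 0 < bandwidth S \<and> 0 < det_threshold S \<and>
     0 < light_speed S \<and> 0 < obs_time S \<and> 0 < integration_exponent S \<and>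
     (\<forall>\<theta>\<in>{0..<2*pi}. 0 < rel_velocity S \<theta> \<and> 0 < num_subcarriers S \<theta> \<and>
        0 < num_symbols S \<theta> \<and> 0 < efficiency S \<theta>) \<and>
     set_borel_measurable lborel {0..<2*pi} (rel_velocity S) \<and>
     set_borel_measurable lborel {0..<2*pi} (\<lambda>\<theta>. real (num_subcarriers S \<theta>)) \<and>
     set_borel_measurable lborel {0..<2*pi} (\<lambda>\<theta>. real (num_symbols S \<theta>)) \<and>
     set_borel_measurable lborel {0..<2*pi} (efficiency S)"

definition T_CPI :: "sensing_system \<Rightarrow> real \<Rightarrow> real" where
  "T_CPI S \<theta> = min (light_speed S / (2 * bandwidth S * rel_velocity S \<theta>)) (obs_time S)"

definition figure_of_merit :: "sensing_system \<Rightarrow> real \<Rightarrow> real" where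
  "figure_of_merit S \<theta> =
     (eirp S * rx_gain S * (wavelength S)\<^sup>2 * radar_cross_section S *
        real (num_subcarriers S \<theta>) * real (num_symbols S \<theta>) * efficiency S \<theta>) /
     ((4 * pi) ^ 3 * boltzmann S * system_temp S * bandwidth S * det_threshold S)"

(* Number of CPIs available in the sensing time, relaxed to a real number (no rounding). *)
definition relaxed_cpis :: "sensing_system \<Rightarrow> real \<Rightarrow> real \<Rightarrow> real" where
  "relaxed_cpis S \<theta> x = x * obs_time S / T_CPI S \<theta>"

definition integrated_cpis :: "sensing_system \<Rightarrow> real \<Rightarrow> real \<Rightarrow> real" where
  "integrated_cpis S \<theta> x = min (relaxed_cpis S \<theta> x) (max_beam_cpis S \<theta>)"

definition R_max :: "sensing_system \<Rightarrow> real \<Rightarrow> real \<Rightarrow> real" where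
  "R_max S \<theta> x =
     root 4 (figure_of_merit S \<theta> * integrated_cpis S \<theta> x powr integration_exponent S)"

definition admissible :: "sensing_system \<Rightarrow> (real \<Rightarrow> real) \<Rightarrow> real \<Rightarrow> real \<Rightarrow> bool" where
  "admissible S R_target \<theta> x \<longleftrightarrow> R_max S \<theta> x \<ge> R_target \<theta> \<and> 0 \<le> x \<and> x \<le> 1"

definition feasible :: "sensing_system \<Rightarrow> (real \<Rightarrow> real) \<Rightarrow> (real \<Rightarrow> real) \<Rightarrow> bool" where
  "feasible S R_target \<rho> \<longleftrightarrow>
     set_borel_measurable lborel {0..<2*pi} \<rho> \<and>
     (\<forall>\<theta>\<in>{0..<2*pi}. admissible S R_target \<theta> (\<rho> \<theta>))"

definition throughput :: "(real \<Rightarrow> real) \<Rightarrow> (real \<Rightarrow> real) \<Rightarrow> (real \<Rightarrow> real) \<Rightarrow> real" where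
  "throughput R_full w \<rho> = (LBINT \<theta>:{0..<2*pi}. (1 - \<rho> \<theta>) * R_full \<theta> * w \<theta>)"

end

theory Submission
  imports Defs
begin

text \<open>The detection range is nondecreasing in the fraction \<open>x\<close> allotted to sensing, while the throughput
  decreases in \<open>x\<close>. So at each phase the smallest admissible fraction is optimal. When the beam limit
  does not bind there, this is the fraction at which the relaxed number of integrated CPIs equals
  \<open>(R_target\<^sup>4 / C) powr (1 / \<kappa>)\<close>. Its being at most 1 is inherited from any feasible
  allocation.\<close>

text \<open>On the nonnegative reals the powers with exponents \<open>\<kappa>\<close> and
  \<open>1 / \<kappa>\<close> are monotone and mutually inverse. The value 0 is included, since
  \<open>0 powr a = 0\<close>.\<close>

lemma powr_root_le_iff:
  fixes y K \<kappa> :: real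
  assumes "0 \<le> y" "0 \<le> K" "0 < \<kappa>"
  shows "y powr (1 / \<kappa>) \<le> K \<longleftrightarrow> y \<le> K powr \<kappa>"
proof
  assume "y powr (1 / \<kappa>) \<le> K"
  then have "(y powr (1 / \<kappa>)) powr \<kappa> \<le> K powr \<kappa>"
    using assms by (intro powr_mono2) auto
  then show "y \<le> K powr \<kappa>"
    using assms by (simp add: powr_powr)
next
  assume "y \<le> K powr \<kappa>"
  then have "y powr (1 / \<kappa>) \<le> (K powr \<kappa>) powr (1 / \<kappa>)"
    using assms by (intro powr_mono2) auto
  then show "y powr (1 / \<kappa>) \<le> K"
    using assms by (simp add: powr_powr)
qed

lemma le_root_iff:
  fixes x y :: real
  assumes "0 < n" "0 \<le> x" "0 \<le> y"
  shows "x \<le> root n y \<longleftrightarrow> x ^ n \<le> y"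
  by (metis assms real_root_le_iff real_root_power_cancel)

text \<open>The value of \<open>x\<close> solving \<open>figure_of_merit S \<theta> * relaxed_cpis S
  \<theta> x powr integration_exponent S = R_target \<theta> ^ 4\<close>, that is, the range
  equation without the beam limit.\<close>

definition min_fraction :: "sensing_system \<Rightarrow> (real \<Rightarrow> real) \<Rightarrow> real \<Rightarrow> real" where
  "min_fraction S R_target \<theta> = T_CPI S \<theta> / obs_time S *
     (R_target \<theta> ^ 4 / figure_of_merit S \<theta>) powr (1 / integration_exponent S)"

lemma
  assumes "valid_system S" "\<theta> \<in> {0..<2*pi}"
  shows T_CPI_pos: "0 < T_CPI S \<theta>"
    and figure_of_merit_pos: "0 < figure_of_merit S \<theta>"
  using assms by (auto simp: valid_system_def T_CPI_def figure_of_merit_def)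

lemma min_fraction_nonneg:
  assumes "valid_system S" "\<theta> \<in> {0..<2*pi}"
  shows "0 \<le> min_fraction S R_target \<theta>"
  using T_CPI_pos[OF assms] assms(1) by (simp add: min_fraction_def valid_system_def)

lemma relaxed_cpis_min_fraction:
  assumes "valid_system S" "\<theta> \<in> {0..<2*pi}"
  shows "relaxed_cpis S \<theta> (min_fraction S R_target \<theta>) =
    (R_target \<theta> ^ 4 / figure_of_merit S \<theta>) powr (1 / integration_exponent S)"
  using T_CPI_pos[OF assms] assms(1)
  by (simp add: min_fraction_def relaxed_cpis_def valid_system_def)

text \<open>The beam limit is at least the CPI count needed to reach the target range, so truncating
  at it cannot change whether that count is reached. Hence the limit only has to be compared with
  the count at the minimal fraction, even though it may truncate the count at a larger
  \<open>x\<close>.\<close>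

lemma R_target_le_R_max_iff:
  assumes S: "valid_system S" and \<theta>: "\<theta> \<in> {0..<2*pi}"
    and R: "0 \<le> R_target \<theta>" and x: "0 \<le> x"
    and nonbinding: "relaxed_cpis S \<theta> (min_fraction S R_target \<theta>) \<le> max_beam_cpis S \<theta>"
  shows "R_target \<theta> \<le> R_max S \<theta> x \<longleftrightarrow> min_fraction S R_target \<theta> \<le> x"
proof -
  have T: "0 < T_CPI S \<theta>" and C: "0 < figure_of_merit S \<theta>"
    using S \<theta> by (rule T_CPI_pos figure_of_merit_pos)+
  have obs: "0 < obs_time S" and \<kappa>: "0 < integration_exponent S"
    using S by (auto simp: valid_system_def)
  define K0 where
    "K0 = (R_target \<theta> ^ 4 / figure_of_merit S \<theta>) powr (1 / integration_exponent S)"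
  have K0: "relaxed_cpis S \<theta> (min_fraction S R_target \<theta>) = K0"
    unfolding K0_def by (rule relaxed_cpis_min_fraction[OF S \<theta>])
  have beam: "K0 \<le> max_beam_cpis S \<theta>"
    using nonbinding K0 by simp
  moreover have "0 \<le> K0"
    by (simp add: K0_def)
  moreover have "0 \<le> relaxed_cpis S \<theta> x"
    using T obs x by (simp add: relaxed_cpis_def)
  \<comment> \<open>The beam limit has no prescribed sign; it is nonnegative here because it
    dominates \<open>K0\<close>. A nonnegative count is what allows the power to be inverted
    below.\<close>
  ultimately have K: "0 \<le> integrated_cpis S \<theta> x"
    by (simp add: integrated_cpis_def)
  have "R_target \<theta> \<le> R_max S \<theta> x \<longleftrightarrow>
      R_target \<theta> ^ 4 / figure_of_merit S \<theta> \<le> integrated_cpis S \<theta> x powr integration_exponent S"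
    unfolding R_max_def using C R by (subst le_root_iff) (auto simp: field_simps)
  also have "\<dots> \<longleftrightarrow> K0 \<le> integrated_cpis S \<theta> x"
    unfolding K0_def using C R K \<kappa> by (subst powr_root_le_iff) auto
  also have "\<dots> \<longleftrightarrow> K0 \<le> relaxed_cpis S \<theta> x"
    using beam by (auto simp: integrated_cpis_def)
  also have "\<dots> \<longleftrightarrow> min_fraction S R_target \<theta> \<le> x"
    unfolding K0[symmetric] relaxed_cpis_def using T obs by (simp add: divide_le_cancel)
  finally show ?thesis .
qed

lemma set_borel_measurable_min_fraction:
  assumes S: "valid_system S" and R: "set_borel_measurable lborel {0..<2*pi} R_target"
  shows "set_borel_measurable lborel {0..<2*pi} (min_fraction S R_target)"
proof -
  let ?I = "\<lambda>\<theta>. indicator {0..<2*pi} \<theta> :: real"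
  have [measurable]:
    "(\<lambda>\<theta>. ?I \<theta> * rel_velocity S \<theta>) \<in> borel_measurable lborel"
    "(\<lambda>\<theta>. ?I \<theta> * real (num_subcarriers S \<theta>)) \<in> borel_measurable lborel"
    "(\<lambda>\<theta>. ?I \<theta> * real (num_symbols S \<theta>)) \<in> borel_measurable lborel"
    "(\<lambda>\<theta>. ?I \<theta> * efficiency S \<theta>) \<in> borel_measurable lborel"
    "(\<lambda>\<theta>. ?I \<theta> * R_target \<theta>) \<in> borel_measurable lborel"
    using S R by (auto simp: valid_system_def set_borel_measurable_def)
  \<comment> \<open>Measurability is known only for the data multiplied by the indicator, so the
    indicator is inserted at every phase-dependent datum. On the interval it equals 1; elsewhere the
    outer factor makes both sides 0, whatever the inner quotients are.\<close>
  have "(\<lambda>\<theta>. ?I \<theta> * min_fraction S R_target \<theta>) = (\<lambda>\<theta>. ?I \<theta> *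
      (min (light_speed S / (2 * bandwidth S * (?I \<theta> * rel_velocity S \<theta>))) (obs_time S) / obs_time S *
      ((?I \<theta> * R_target \<theta>) ^ 4 /
        ((eirp S * rx_gain S * (wavelength S)\<^sup>2 * radar_cross_section S *
          (?I \<theta> * real (num_subcarriers S \<theta>)) * (?I \<theta> * real (num_symbols S \<theta>)) *
          (?I \<theta> * efficiency S \<theta>)) /
        ((4 * pi) ^ 3 * boltzmann S * system_temp S * bandwidth S * det_threshold S)))
        powr (1 / integration_exponent S)))"
    by (auto simp: fun_eq_iff min_fraction_def T_CPI_def figure_of_merit_def indicator_def)
  also have "\<dots> \<in> borel_measurable lborel"
    by measurable
  finally show ?thesis
    by (simp add: set_borel_measurable_def)
qed

text \<open>Since \<open>\<rho>\<close> takes values between 0 and 1 on the interval, the integrand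
  is dominated by \<open>R_full \<theta> * w \<theta>\<close>.\<close>

lemma set_integrable_throughput:
  assumes \<rho>: "feasible S R_target \<rho>"
    and int: "set_integrable lborel {0..<2*pi} (\<lambda>\<theta>. R_full \<theta> * w \<theta>)"
  shows "set_integrable lborel {0..<2*pi} (\<lambda>\<theta>. (1 - \<rho> \<theta>) * R_full \<theta> * w \<theta>)"
proof -
  let ?I = "\<lambda>\<theta>. indicator {0..<2*pi} \<theta> :: real"
  have int': "integrable lborel (\<lambda>\<theta>. ?I \<theta> * (R_full \<theta> * w \<theta>))"
    using int by (simp add: set_integrable_def)
  then have [measurable]: "(\<lambda>\<theta>. ?I \<theta> * (R_full \<theta> * w \<theta>)) \<in> borel_measurable lborel"
    by (rule borel_measurable_integrable)
  have [measurable]: "(\<lambda>\<theta>. ?I \<theta> * \<rho> \<theta>) \<in> borel_measurable lborel"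
    using \<rho> by (simp add: feasible_def set_borel_measurable_def)
  \<comment> \<open>Cutting off \<open>\<rho>\<close> by the indicator makes the first factor
    measurable and bounded by 1 on the whole line, since off the interval it equals 1.\<close>
  have "integrable lborel (\<lambda>\<theta>. (1 - ?I \<theta> * \<rho> \<theta>) * (?I \<theta> * (R_full \<theta> * w \<theta>)))"
  proof (rule Bochner_Integration.integrable_bound[OF int'])
    have "\<bar>1 - ?I \<theta> * \<rho> \<theta>\<bar> \<le> 1" for \<theta>
      using \<rho> by (auto simp: feasible_def admissible_def indicator_def)
    then show "AE \<theta> in lborel. norm ((1 - ?I \<theta> * \<rho> \<theta>) * (?I \<theta> * (R_full \<theta> * w \<theta>)))
        \<le> norm (?I \<theta> * (R_full \<theta> * w \<theta>))"
      by (auto simp: abs_mult intro!: mult_left_le_one_le)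
  qed measurable
  moreover have "(\<lambda>\<theta>. (1 - ?I \<theta> * \<rho> \<theta>) * (?I \<theta> * (R_full \<theta> * w \<theta>))) =
      (\<lambda>\<theta>. ?I \<theta> *\<^sub>R ((1 - \<rho> \<theta>) * R_full \<theta> * w \<theta>))"
    by (auto simp: indicator_def)
  ultimately show ?thesis
    by (simp add: set_integrable_def)
qed

theorem proposition4:
  fixes \<mu> P :: real
    and X V :: "real \<Rightarrow> real^3"
    and \<phi> w R_full R_target \<rho>_opt :: "real \<Rightarrow> real"
    and S :: sensing_system
  assumes "0 < \<mu>" and "\<mu> < 1"
    and "cr3bp_trajectory \<mu> X V"
    and "has_least_period X P"
    and "orbit_phase P \<phi>"
    and "dwell_time_weight P \<phi> w"
    and "valid_system S"
    and "\<forall>\<theta>\<in>{0..<2*pi}. 0 \<le> R_full \<theta>"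
    and "set_integrable lborel {0..<2*pi} (\<lambda>\<theta>. R_full \<theta> * w \<theta>)"
    and "\<forall>\<theta>\<in>{0..<2*pi}. 0 \<le> R_target \<theta>"
    and "set_borel_measurable lborel {0..<2*pi} R_target"
    and feasible: "\<exists>\<rho>. feasible S R_target \<rho>"
    and solution: "\<rho>_opt = (\<lambda>\<theta>. T_CPI S \<theta> / obs_time S *
           (R_target \<theta> ^ 4 / figure_of_merit S \<theta>) powr (1 / integration_exponent S))"
    and nonbinding: "\<forall>\<theta>\<in>{0..<2*pi}. relaxed_cpis S \<theta> (\<rho>_opt \<theta>) \<le> max_beam_cpis S \<theta>"
  shows "is_arg_max (throughput R_full w) (feasible S R_target) \<rho>_opt \<and>
         (\<forall>\<theta>\<in>{0..<2*pi}.
            is_arg_max (\<lambda>x. (1 - x) * R_full \<theta> * w \<theta>) (admissible S R_target \<theta>) (\<rho>_opt \<theta>))"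
proof -
  have opt: "\<rho>_opt = min_fraction S R_target"
    by (auto simp: solution min_fraction_def)
  have w: "0 \<le> w \<theta>" if "\<theta> \<in> {0..<2*pi}" for \<theta>
    using \<open>dwell_time_weight P \<phi> w\<close> that by (auto simp: dwell_time_weight_def)
  \<comment> \<open>The range constraint becomes a lower bound on \<open>x\<close>, so the feasible
    set at each phase is an interval with left end \<open>\<rho>_opt \<theta>\<close>, possibly
    empty until the upper bound 1 is checked.\<close>
  have admissible_iff:
    "admissible S R_target \<theta> x \<longleftrightarrow> 0 \<le> x \<and> x \<le> 1 \<and> \<rho>_opt \<theta> \<le> x"
    if "\<theta> \<in> {0..<2*pi}" for \<theta> x
    using R_target_le_R_max_iff[of S \<theta> R_target x] that assms opt
    by (auto simp: admissible_def)
  obtain \<rho>0 where \<rho>0: "feasible S R_target \<rho>0"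
    using feasible by blast
  have opt_admissible: "admissible S R_target \<theta> (\<rho>_opt \<theta>)" if "\<theta> \<in> {0..<2*pi}" for \<theta>
  proof -
    have "admissible S R_target \<theta> (\<rho>0 \<theta>)"
      using \<rho>0 that by (simp add: feasible_def)
    then have "\<rho>_opt \<theta> \<le> 1"
      using admissible_iff[OF that] by simp
    then show ?thesis
      using min_fraction_nonneg[OF \<open>valid_system S\<close> that] admissible_iff[OF that]
      by (simp add: opt)
  qed
  have opt_feasible: "feasible S R_target \<rho>_opt"
    unfolding feasible_def
    using opt_admissible set_borel_measurable_min_fraction[of S R_target, folded opt] assms(7,11)
    by blast
  \<comment> \<open>Both \<open>R_full\<close> and the dwell-time weight are nonnegative, so the
    integrand does not increase with \<open>x\<close>.\<close>
  have pointwise: "(1 - x) * R_full \<theta> * w \<theta> \<le> (1 - \<rho>_opt \<theta>) * R_full \<theta> * w \<theta>"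
    if "\<theta> \<in> {0..<2*pi}" "admissible S R_target \<theta> x" for \<theta> x
    using that admissible_iff[of \<theta> x] w assms by (intro mult_right_mono) auto
  have "throughput R_full w \<rho> \<le> throughput R_full w \<rho>_opt" if \<rho>: "feasible S R_target \<rho>" for \<rho>
    unfolding throughput_def
  \<comment> \<open>Integrability of both sides matters: the integral of a nonintegrable function
    defaults to 0, which would break the comparison.\<close>
  proof (rule set_integral_mono)
    show "set_integrable lborel {0..<2*pi} (\<lambda>\<theta>. (1 - \<rho> \<theta>) * R_full \<theta> * w \<theta>)"
      "set_integrable lborel {0..<2*pi} (\<lambda>\<theta>. (1 - \<rho>_opt \<theta>) * R_full \<theta> * w \<theta>)"
      using \<rho> opt_feasible assms by (auto intro: set_integrable_throughput)
  qed (use pointwise \<rho> in \<open>auto simp: feasible_def\<close>)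
  \<comment> \<open>\<open>is_arg_max\<close> asks that no competitor be strictly better; for real
    values this is the upper bound just proved.\<close>
  then show ?thesis
    using opt_feasible opt_admissible pointwise by (fastforce simp: is_arg_max_def not_less)
qed

end
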